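(* Consider the multi-agent MILP $(\mathcal{P})$ and the infinite sequences $\{x_i(k)\}_{k\ge 1}$ ($i=1,\dots,m$), $\{\lambda(k)\}_{k\ge 0}$, $\{\rho(k)\}_{k\ge 1}$ generated by Algorithm 1, both described in the context. Assume that: (Boundedness) the sets $X_i$, $i=1,\dots,m$, are bounded; (Uniqueness) the problems $\overline{\mathcal{P}}_{\mathrm{LP}}$ and $\overline{\mathcal{D}}$ defined in the context (which involve the limiting value $\bar\rho$ of $\{\rho(k)\}_{k\ge1}$) have unique solutions $\bar{x}^\star_{\mathrm{LP}}$ and $\bar\lambda^\star$, respectively. Then there exists a finite iteration index $K$ such that, for all $k\ge K$, $x(k)=[x_1(k)^\top\;\cdots\;x_m(k)^\top]^\top$ is a feasible solution for $(\mathcal{P})$, i.e., $\sum_{i=1}^m A_i x_i(k)\le b$ and $x_i(k)\in X_i$ for $i=1,\dots,m$, for all $k\ge K$.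
   Context: All vector inequalities, and $\max$/$\min$ of vectors in $\mathbb{R}^p$, are component-wise; $[\,\cdot\,]_+$ denotes projection onto the non-negative orthant $\mathbb{R}^p_+$. Problem $(\mathcal{P})$: given $m$ agents, minimize $\sum_{i=1}^m c_i^\top x_i$ over $x_1,\dots,x_m$ subject to $\sum_{i=1}^m A_i x_i\le b$ and $x_i\in X_i$, $i=1,\dots,m$, where $c_i\in\mathbb{R}^{n_i}$, $A_i\in\mathbb{R}^{p\times n_i}$, $b\in\mathbb{R}^p$, and $X_i=\{x_i\in\mathbb{R}^{n_{c,i}}\times\mathbb{Z}^{n_{d,i}}: D_i x_i\le d_i\}$ is non-empty, with $n_{c,i}+n_{d,i}=n_i$ and $D_i,d_i$ a matrix and a vector of appropriate dimensions. $\mathrm{conv}(X_i)$ is the convex hull of $X_i$, and $\mathrm{vert}(X_i)$ denotes the set of vertices (extreme points) of $\mathrm{conv}(X_i)$; when $X_i$ is bounded this is a finite non-empty subset of $X_i$. Algorithm 1: the step sizes $\alpha(k)>0$ satisfy $\lim_{k\to\infty}\alpha(k)=0$ and $\sum_{k=0}^\infty\alpha(k)=\infty$. Initialize $\lambda(0)=0\in\mathbb{R}^p$ and, for $i=1,\dots,m$, $\bar s_i(0)=-\infty$, $\underline{s}_i(0)=+\infty$ (all components). For $k=0,1,2,\dots$: 1. for each $i$, $x_i(k+1)\in\arg\min_{x_i\in\mathrm{vert}(X_i)}(c_i^\top+\lambda(k)^\top A_i)x_i$, ties being broken by a deterministic rule; 2. for each $i$, $\bar s_i(k+1)=\max\{\bar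 s_i(k),A_ix_i(k+1)\}$, $\underline{s}_i(k+1)=\min\{\underline{s}_i(k),A_ix_i(k+1)\}$, $\rho_i(k+1)=\bar s_i(k+1)-\underline{s}_i(k+1)$; 3. $\rho(k+1)=p\max\{\rho_1(k+1),\dots,\rho_m(k+1)\}$; 4. $\lambda(k+1)=\big[\lambda(k)+\alpha(k)\big(\sum_{i=1}^m A_ix_i(k+1)-b+\rho(k+1)\big)\big]_+$. The algorithm is run without stopping, so infinite sequences are generated. When the $X_i$ are bounded, $\{\rho(k)\}_{k\ge1}$ is component-wise non-decreasing and takes values in a finite set, hence it is eventually constant; $\bar\rho\in\mathbb{R}^p$ denotes its limiting value. $\overline{\mathcal{P}}_{\mathrm{LP}}$ is the linear program: minimize $\sum_{i=1}^m c_i^\top x_i$ subject to $\sum_{i=1}^m A_ix_i\le b-\bar\rho$ and $x_i\in\mathrm{conv}(X_i)$, $i=1,\dots,m$. $\overline{\mathcal{D}}$ is its dual: $\max_{\lambda\ge0}\ -\lambda^\top(b-\bar\rho)+\sum_{i=1}^m\min_{x_i\in X_i}(c_i^\top+\lambda^\top A_i)x_i$. *)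

theory Defs
  imports "HOL-Analysis.Analysis"
begin

text \<open>
  The agents are the elements of a finite type \<open>'m\<close>, and \<open>\<real>\<^sup>p\<close> is \<open>real ^ 'p\<close>.
  The agents' spaces of different dimensions \<open>n\<^sub>i = n\<^sub>c\<^sub>i + n\<^sub>d\<^sub>i\<close> are realized as coordinate
  subspaces of one \<open>real ^ 'n\<close>: agent \<open>i\<close> uses the continuous coordinates \<open>Nc i\<close> and the integer
  coordinates \<open>Nd i\<close> (two disjoint sets, of sizes \<open>n\<^sub>c\<^sub>i\<close> and \<open>n\<^sub>d\<^sub>i\<close>), and its vectors vanish
  elsewhere, so the other entries of \<open>c i\<close> and other columns of \<open>A i\<close> and \<open>D i\<close> play no role.
  The numbers of rows of the matrices \<open>D i\<close> are made equal by padding with rows \<open>0 \<le> 0\<close>.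
  The order on \<open>real ^ 'k\<close> is component-wise.
\<close>

definition mixed_integer_polyhedron ::
    "'n set \<Rightarrow> 'n set \<Rightarrow> real^'n^'q \<Rightarrow> real^'q \<Rightarrow> (real^'n) set"
  where "mixed_integer_polyhedron Nc Nd D d =
    {x. (\<forall>j. j \<notin> Nc \<union> Nd \<longrightarrow> x $ j = 0) \<and> (\<forall>j\<in>Nd. x $ j \<in> \<int>) \<and> D *v x \<le> d}"

definition vert :: "(real^'n) set \<Rightarrow> (real^'n) set"
  where "vert S = {v. v extreme_point_of (convex hull S)}"

definition total_cost :: "('m::finite \<Rightarrow> real^'n) \<Rightarrow> ('m \<Rightarrow> real^'n) \<Rightarrow> real"
  where "total_cost c x = (\<Sum>i\<in>UNIV. c i \<bullet> x i)"

definition feasible ::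
    "('m::finite \<Rightarrow> real^'n^'p) \<Rightarrow> real^'p \<Rightarrow> ('m \<Rightarrow> (real^'n) set) \<Rightarrow> ('m \<Rightarrow> real^'n) \<Rightarrow> bool"
  where "feasible A b X x \<longleftrightarrow> (\<Sum>i\<in>UNIV. A i *v x i) \<le> b \<and> (\<forall>i. x i \<in> X i)"

definition lp_solution ::
    "('m::finite \<Rightarrow> real^'n) \<Rightarrow> ('m \<Rightarrow> real^'n^'p) \<Rightarrow> real^'p \<Rightarrow> ('m \<Rightarrow> (real^'n) set) \<Rightarrow> real^'p
      \<Rightarrow> ('m \<Rightarrow> real^'n) \<Rightarrow> bool"
  where "lp_solution c A b X \<rho> x \<longleftrightarrow>
    is_arg_min (total_cost c) (feasible A (b - \<rho>) (\<lambda>i. convex hull X i)) x"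

text \<open>The infimum below is a minimum whenever \<open>X i\<close> is bounded and non-empty.\<close>

definition dual_objective ::
    "('m::finite \<Rightarrow> real^'n) \<Rightarrow> ('m \<Rightarrow> real^'n^'p) \<Rightarrow> real^'p \<Rightarrow> ('m \<Rightarrow> (real^'n) set) \<Rightarrow> real^'p
      \<Rightarrow> real^'p \<Rightarrow> real"
  where "dual_objective c A b X \<rho> l =
    - (l \<bullet> (b - \<rho>)) + (\<Sum>i\<in>UNIV. INF x\<in>X i. (c i + l v* A i) \<bullet> x)"

definition dual_solution ::
    "('m::finite \<Rightarrow> real^'n) \<Rightarrow> ('m \<Rightarrow> real^'n^'p) \<Rightarrow> real^'p \<Rightarrow> ('m \<Rightarrow> (real^'n) set) \<Rightarrow> real^'p
      \<Rightarrow> real^'p \<Rightarrow> bool"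
  where "dual_solution c A b X \<rho> l \<longleftrightarrow>
    is_arg_max (dual_objective c A b X \<rho>) (\<lambda>l. 0 \<le> l) l"

definition orthant_proj :: "real^'p \<Rightarrow> real^'p"
  where "orthant_proj v = closest_point {w. 0 \<le> w} v"

definition step_sizes :: "(nat \<Rightarrow> real) \<Rightarrow> bool"
  where "step_sizes \<alpha> \<longleftrightarrow>
    (\<forall>k. \<alpha> k > 0) \<and> \<alpha> \<longlonglongrightarrow> 0 \<and> filterlim (\<lambda>n. \<Sum>k<n. \<alpha> k) at_top sequentially"

text \<open>
  A deterministic tie-breaking rule is a function \<open>sel\<close> that picks, for every agent and every
  multiplier, one of the minimizers.
\<close>

definition minimizer_rule ::
    "('m::finite \<Rightarrow> real^'n) \<Rightarrow> ('m \<Rightarrow> real^'n^'p) \<Rightarrow> ('m \<Rightarrow> (real^'n) set)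
      \<Rightarrow> ('m \<Rightarrow> real^'p \<Rightarrow> real^'n) \<Rightarrow> bool"
  where "minimizer_rule c A X sel \<longleftrightarrow>
    (\<forall>i l. 0 \<le> l \<longrightarrow>
      is_arg_min (\<lambda>x. (c i + l v* A i) \<bullet> x) (\<lambda>x. x \<in> vert (X i)) (sel i l))"

text \<open>
  The sequences \<open>x\<close>, \<open>\<rho>i\<close> and \<open>\<rho>\<close> start at index 1; their values at 0 are unconstrained.
  The running extrema \<open>smax\<close> and \<open>smin\<close> are infinite only at index 0, so that the conversion
  from extended reals below is applied to finite values only.
\<close>

definition generated_by_algorithm ::
    "('m::finite \<Rightarrow> real^'n) \<Rightarrow> ('m \<Rightarrow> real^'n^'p) \<Rightarrow> real^'p \<Rightarrow> (nat \<Rightarrow> real)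
      \<Rightarrow> ('m \<Rightarrow> real^'p \<Rightarrow> real^'n)
      \<Rightarrow> (nat \<Rightarrow> 'm \<Rightarrow> real^'n) \<Rightarrow> (nat \<Rightarrow> 'm \<Rightarrow> 'p \<Rightarrow> ereal) \<Rightarrow> (nat \<Rightarrow> 'm \<Rightarrow> 'p \<Rightarrow> ereal)
      \<Rightarrow> (nat \<Rightarrow> 'm \<Rightarrow> real^'p) \<Rightarrow> (nat \<Rightarrow> real^'p) \<Rightarrow> (nat \<Rightarrow> real^'p) \<Rightarrow> bool"
  where "generated_by_algorithm c A b \<alpha> sel x smax smin \<rho>i \<rho> lam \<longleftrightarrow>
    lam 0 = 0 \<and> (\<forall>i j. smax 0 i j = - \<infinity>) \<and> (\<forall>i j. smin 0 i j = \<infinity>) \<and>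
    (\<forall>k.
      (\<forall>i. x (Suc k) i = sel i (lam k)) \<and>
      (\<forall>i j. smax (Suc k) i j = max (smax k i j) (ereal ((A i *v x (Suc k) i) $ j))) \<and>
      (\<forall>i j. smin (Suc k) i j = min (smin k i j) (ereal ((A i *v x (Suc k) i) $ j))) \<and>
      (\<forall>i. \<rho>i (Suc k) i = (\<chi> j. real_of_ereal (smax (Suc k) i j - smin (Suc k) i j))) \<and>
      \<rho> (Suc k) = (\<chi> j. real CARD('p) * (MAX i. \<rho>i (Suc k) i $ j)) \<and>
      lam (Suc k) =
        orthant_proj (lam k + \<alpha> k *\<^sub>R ((\<Sum>i\<in>UNIV. A i *v x (Suc k) i) - b + \<rho> (Suc k))))"

end

theory Submission
  imports Defs
begin

text \<open>
  Once \<open>\<rho>\<close> has reached its limit \<open>\<rho>lim\<close>, the algorithm is a subgradient ascent for the dual of the LP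
  with right-hand side \<open>r = b - \<rho>lim\<close>. Consider the set of residuals \<open>\<Sum>\<^sub>i A\<^sub>i y\<^sub>i - r + s\<close>, where \<open>y\<^sub>i\<close> ranges
  over convex combinations of the vertices that are optimal at the dual solution \<open>l0\<close> and the slack
  \<open>s \<ge> 0\<close> is complementary to \<open>l0\<close>. Uniqueness of \<open>l0\<close> says that \<open>0\<close> is an interior point of this set.
  This has two consequences. The maximum of the dual function is sharp, so the multipliers converge to
  \<open>l0\<close> for all step sizes that tend to 0 and have a divergent sum. And the LP solution \<open>z\<close> gives positive weight to all
  optimal vertices, so that its uniqueness leaves at most \<open>p\<close> agents with more than one optimal vertex;
  all the other agents eventually choose \<open>x\<^sub>i = z\<^sub>i\<close>. Finally \<open>z\<^sub>i\<close> is a convex combination of the points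
  generated by agent \<open>i\<close>, since otherwise a separating hyperplane would force the multipliers to
  diverge. Hence \<open>A\<^sub>i x\<^sub>i - A\<^sub>i z\<^sub>i\<close> is at most the observed range \<open>\<rho>\<^sub>i\<close>, and the at most \<open>p\<close> deviating agents
  consume no more than \<open>\<rho>lim\<close> in total.
\<close>

subsection \<open>Step sizes, projections and polytopes\<close>

text \<open>Telescoping from \<open>K\<close> on bounds \<open>u n\<close> below by a constant plus
  \<open>\<delta>\<close> times a partial sum of the steps.\<close>

lemma filterlim_at_top_increments:
  fixes u \<alpha> :: "nat \<Rightarrow> real"
  assumes sum: "filterlim (\<lambda>n. \<Sum>k<n. \<alpha> k) at_top sequentially" and "\<delta> > 0"
    and step: "\<And>k. k \<ge> K \<Longrightarrow> u k + \<delta> * \<alpha> k \<le> u (Suc k)"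
  shows "filterlim u at_top sequentially"
proof -
  have lower: "u K - \<delta> * (\<Sum>k<K. \<alpha> k) + \<delta> * (\<Sum>k<n. \<alpha> k) \<le> u n" if "n \<ge> K" for n
    using that
  proof (induction n rule: dec_induct)
    case (step n)
    then show ?case using assms(3)[of n] by (simp add: algebra_simps)
  qed simp
  have "filterlim (\<lambda>n. u K - \<delta> * (\<Sum>k<K. \<alpha> k) + \<delta> * (\<Sum>k<n. \<alpha> k)) at_top sequentially"
    by (intro filterlim_tendsto_add_at_top[OF tendsto_const]
        filterlim_tendsto_pos_mult_at_top[OF tendsto_const \<open>\<delta> > 0\<close> sum])
  then show ?thesis
    by (rule filterlim_at_top_mono) (use lower in \<open>auto simp: eventually_at_top_linorder\<close>)
qed

text \<open>
  As long as \<open>r k \<ge> \<epsilon>\<close> and the step is small, the linear decrease dominates the quadratic error,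
  so \<open>r\<close> must drop below \<open>\<epsilon>\<close>; afterwards one step cannot lift \<open>(r k)\<^sup>2\<close> above \<open>2 \<epsilon>\<^sup>2\<close>.
\<close>

lemma sharp_descent_tendsto_zero:
  fixes r \<alpha> :: "nat \<Rightarrow> real"
  assumes steps: "step_sizes \<alpha>" and "\<kappa> > 0" and G: "G > 0" and nonneg: "\<And>k. 0 \<le> r k"
    and descent: "\<And>k. (r (Suc k))\<^sup>2 \<le> (r k)\<^sup>2 - 2 * \<kappa> * \<alpha> k * r k + (\<alpha> k * G)\<^sup>2"
  shows "r \<longlonglongrightarrow> 0"
proof -
  have \<alpha>pos: "\<And>k. \<alpha> k > 0" and \<alpha>0: "\<alpha> \<longlonglongrightarrow> 0"
    and sum: "filterlim (\<lambda>n. \<Sum>k<n. \<alpha> k) at_top sequentially"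
    using steps by (auto simp: step_sizes_def)
  have "\<forall>\<^sub>F k in sequentially. (r k)\<^sup>2 \<le> 2 * \<epsilon>\<^sup>2" if "\<epsilon> > 0" for \<epsilon>
  proof -
    \<comment> \<open>The first bound keeps the quadratic error below half of the linear decrease
      while \<open>r k \<ge> \<epsilon>\<close>; the second makes the error of one step at most
      \<open>\<epsilon>\<^sup>2\<close>.\<close>
    have "\<forall>\<^sub>F k in sequentially. \<alpha> k < min (\<kappa> * \<epsilon> / G\<^sup>2) (\<epsilon> / G)"
      using \<alpha>0 G \<open>\<kappa> > 0\<close> \<open>\<epsilon> > 0\<close> by (intro order_tendstoD(2)) auto
    then obtain K where K: "\<And>k. k \<ge> K \<Longrightarrow> \<alpha> k < min (\<kappa> * \<epsilon> / G\<^sup>2) (\<epsilon> / G)"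
      by (auto simp: eventually_at_top_linorder)
    have small: "\<alpha> k * G\<^sup>2 \<le> \<kappa> * \<epsilon>" "\<alpha> k * G \<le> \<epsilon>" if "k \<ge> K" for k
      using K[OF that] G by (auto simp: field_simps)
    have far: "(r (Suc k))\<^sup>2 + \<kappa> * \<epsilon> * \<alpha> k \<le> (r k)\<^sup>2" if "k \<ge> K" "\<epsilon> \<le> r k" for k
    proof -
      have "2 * \<kappa> * \<alpha> k * \<epsilon> \<le> 2 * \<kappa> * \<alpha> k * r k"
        using that \<alpha>pos[of k] \<open>\<kappa> > 0\<close> by (intro mult_left_mono) auto
      moreover have "(\<alpha> k * G)\<^sup>2 \<le> \<alpha> k * (\<kappa> * \<epsilon>)"
        using mult_left_mono[OF small(1)[OF that(1)], of "\<alpha> k"] \<alpha>pos[of k]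
        by (simp add: power2_eq_square algebra_simps)
      ultimately show ?thesis using descent[of k] by (simp add: algebra_simps)
    qed
    have near: "(r (Suc k))\<^sup>2 \<le> 2 * \<epsilon>\<^sup>2" if "k \<ge> K" "r k \<le> \<epsilon>" for k
    proof -
      have "(r k)\<^sup>2 \<le> \<epsilon>\<^sup>2" "(\<alpha> k * G)\<^sup>2 \<le> \<epsilon>\<^sup>2"
        using small(2)[OF that(1)] that(2) nonneg[of k] \<alpha>pos[of k] G
        by (auto intro!: power_mono)
      moreover have "0 \<le> 2 * \<kappa> * \<alpha> k * r k"
        using \<alpha>pos[of k] \<open>\<kappa> > 0\<close> nonneg[of k] by simp
      ultimately show ?thesis using descent[of k] by linarith
    qed
    have "\<exists>k\<ge>K. r k < \<epsilon>"
    proof (rule ccontr)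
      assume "\<not> ?thesis"
      then have "- (r k)\<^sup>2 + (\<kappa> * \<epsilon>) * \<alpha> k \<le> - (r (Suc k))\<^sup>2" if "k \<ge> K" for k
        using far[of k] that by force
      then have "filterlim (\<lambda>k. - (r k)\<^sup>2) at_top sequentially"
        using \<open>\<kappa> > 0\<close> \<open>\<epsilon> > 0\<close> by (intro filterlim_at_top_increments[OF sum, of "\<kappa> * \<epsilon>"]) auto
      then have "\<forall>\<^sub>F k in sequentially. 1 \<le> - (r k)\<^sup>2"
        unfolding filterlim_at_top by blast
      then obtain k where "1 \<le> - (r k)\<^sup>2"
        by (auto simp: eventually_at_top_linorder)
      then show False using zero_le_power2[of "r k"] by linarith
    qed
    then obtain k0 where k0: "k0 \<ge> K" "r k0 < \<epsilon>" by blast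
    have "(r k)\<^sup>2 \<le> 2 * \<epsilon>\<^sup>2" if "k \<ge> k0" for k
      using that
    proof (induction k rule: dec_induct)
      case base
      have "(r k0)\<^sup>2 \<le> \<epsilon>\<^sup>2" using k0 nonneg by (intro power_mono) auto
      then show ?case using zero_le_power2[of \<epsilon>] by linarith
    next
      case (step k)
      have "0 \<le> \<kappa> * \<epsilon> * \<alpha> k" using \<open>\<kappa> > 0\<close> \<open>\<epsilon> > 0\<close> \<alpha>pos[of k] by simp
      then show ?case
        using near[of k] far[of k] step k0(1) by (cases "r k \<le> \<epsilon>") auto
    qed
    then show ?thesis by (auto simp: eventually_at_top_linorder)
  qed
  note small_eventually = this
  show ?thesis
  proof (rule tendstoI)
    fix e :: real assume "e > 0"
    have "\<forall>\<^sub>F k in sequentially. (r k)\<^sup>2 \<le> 2 * (e / 2)\<^sup>2"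
      using small_eventually \<open>e > 0\<close> by simp
    then show "\<forall>\<^sub>F k in sequentially. dist (r k) 0 < e"
    proof eventually_elim
      case (elim k)
      have "0 < e\<^sup>2" using \<open>e > 0\<close> by simp
      moreover have "2 * (r k)\<^sup>2 \<le> e\<^sup>2" using elim by (simp add: power_divide)
      ultimately have "(r k)\<^sup>2 < e\<^sup>2" by linarith
      then have "r k < e" using \<open>e > 0\<close> by (simp add: power2_less_imp_less)
      then show ?case using nonneg[of k] by simp
    qed
  qed
qed

text \<open>The orthant is a product of half-lines, so the distance is minimized in each coordinate
  separately.\<close>

lemma orthant_proj_eq: "orthant_proj v = (\<chi> j. max 0 (v $ j))"
proof -
  have orthant: "{w :: real^'p. 0 \<le> w} = {w. \<forall>j. 0 \<le> w $ j}"
    by (auto simp: less_eq_vec_def)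
  have "(\<chi> j. max 0 (v $ j)) = closest_point {w. 0 \<le> w} v"
  proof (rule closest_point_unique)
    show "convex {w :: real^'p. 0 \<le> w}" unfolding orthant
      by (auto simp: convex_def)
    show "closed {w :: real^'p. 0 \<le> w}" unfolding orthant
      by (intro closed_Collect_all closed_Collect_le continuous_intros)
    show "\<forall>z\<in>{w. 0 \<le> w}. dist v (\<chi> j. max 0 (v $ j)) \<le> dist v z"
      unfolding orthant dist_vec_def
      by (intro ballI L2_set_mono) (auto simp: dist_real_def, smt (verit))
    show "(\<chi> j. max 0 (v $ j)) \<in> {w. 0 \<le> w}" by (simp add: less_eq_vec_def)
  qed
  then show ?thesis by (simp add: orthant_proj_def)
qed

text \<open>Clipping at 0 moves no coordinate away from a nonnegative target.\<close>

lemma norm_orthant_proj_diff_le: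
  assumes "0 \<le> l" shows "norm (orthant_proj v - l) \<le> norm (v - l)"
  unfolding norm_vec_def
proof (rule L2_set_mono)
  fix j
  have "0 \<le> l $ j" using assms by (simp add: less_eq_vec_def)
  then show "norm ((orthant_proj v - l) $ j) \<le> norm ((v - l) $ j)"
    by (auto simp: orthant_proj_eq)
qed simp

text \<open>Stated for families: if \<open>u\<close> repeats a vector on \<open>I\<close>, the
  coefficients 1 and -1 already give a dependence.\<close>

lemma ex_linear_dependence:
  fixes u :: "'i \<Rightarrow> 'a::euclidean_space"
  assumes "finite I" "DIM('a) < card I"
  obtains t where "\<exists>i\<in>I. t i \<noteq> (0::real)" "(\<Sum>i\<in>I. t i *\<^sub>R u i) = 0"
proof (cases "inj_on u I")
  case True
  then have "dependent (u ` I)"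
    using assms by (intro dependent_biggerset) (auto simp: card_image)
  then obtain w where "(\<Sum>v\<in>u ` I. w v *\<^sub>R v) = 0" "\<exists>v\<in>u ` I. w v \<noteq> (0::real)"
    using dependent_finite[of "u ` I"] assms(1) by auto
  then show thesis
    using that[of "w \<circ> u"] True by (auto simp: sum.reindex)
next
  case False
  then obtain i j where ij: "i \<in> I" "j \<in> I" "i \<noteq> j" "u i = u j"
    by (auto simp: inj_on_def)
  define t where "t k = (if k = i then 1 else if k = j then - 1 else (0::real))" for k
  have "(\<Sum>k\<in>I. t k *\<^sub>R u k) = (\<Sum>k\<in>{i, j}. t k *\<^sub>R u k)"
    using ij assms(1) by (intro sum.mono_neutral_right) (auto simp: t_def)
  also have "\<dots> = 0" using ij by (simp add: t_def)
  finally show thesis using that[of t] ij(1) by (metis t_def zero_neq_one)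
qed

text \<open>If the interior is empty, \<open>C\<close> lies in a hyperplane, and one of its two
  normals works. Otherwise 0 is separated from the interior, and the inequality extends to the
  closure.\<close>

lemma nonneg_functional_if_not_interior:
  fixes C :: "'a::euclidean_space set"
  assumes "convex C" "0 \<notin> interior C"
  obtains h where "h \<noteq> 0" "\<And>y. y \<in> C \<Longrightarrow> 0 \<le> h \<bullet> y"
proof (cases "interior C = {}")
  case True
  then obtain a \<beta> where "a \<noteq> 0" "C \<subseteq> {x. a \<bullet> x = \<beta>}"
    using empty_interior_subset_hyperplane[OF assms(1)] by metis
  then show thesis
    using that[of a] that[of "- a"] by (cases "\<beta> \<ge> 0") force+
next
  case False
  then obtain a \<beta> where a: "a \<noteq> 0" "0 \<le> \<beta>" "\<forall>x\<in>interior C. \<beta> \<le> a \<bullet> x"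
    using separating_hyperplane_sets[of "{0::'a}" "interior C"] assms by auto
  have "closure (interior C) \<subseteq> {x. \<beta> \<le> a \<bullet> x}"
    using a(3) by (intro closure_minimal closed_halfspace_ge) auto
  then have "C \<subseteq> {x. \<beta> \<le> a \<bullet> x}"
    using convex_closure_interior[OF assms(1) False] closure_subset by blast
  then show thesis
    using that[of a] a by force
qed

section \<open>Convex hulls of mixed-integer sets and their vertices\<close>

lemma polyhedron_matrix_le: "polyhedron {x :: real^'n. D *v x \<le> (d :: real^'q)}"
proof -
  have "{x. D *v x \<le> d} = \<Inter> (range (\<lambda>j. {x. row j D \<bullet> x \<le> d $ j}))"
    by (auto simp: less_eq_vec_def matrix_vector_mul_component row_def vec_lambda_eta)
  also have "polyhedron \<dots>" by (intro polyhedron_Inter) (auto simp: polyhedron_halfspace_le)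
  finally show ?thesis .
qed

text \<open>Boundedness leaves finitely many integer parts, and each of them cuts out a polytope.\<close>

lemma mixed_integer_convex_hull_polytope:
  fixes Nc Nd :: "'n::finite set" and D :: "real^'n^'q" and d :: "real^'q"
  assumes "bounded (mixed_integer_polyhedron Nc Nd D d)"
  shows "polytope (convex hull (mixed_integer_polyhedron Nc Nd D d))"
proof -
  let ?X = "mixed_integer_polyhedron Nc Nd D d"
  let ?z = "\<lambda>x. (\<chi> j. if j \<in> Nd then x $ j else 0)"
  define P where "P z = {x. D *v x \<le> d} \<inter>
    (\<Inter>j\<in>- (Nc \<union> Nd). {x. x $ j = 0}) \<inter> (\<Inter>j\<in>Nd. {x. x $ j = z $ j})" for z :: "real^'n"
  obtain B where B: "\<And>x. x \<in> ?X \<Longrightarrow> norm x \<le> B"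
    using assms by (auto simp: bounded_iff)
  have "finite {t :: real. t \<in> \<int> \<and> \<bar>t\<bar> \<le> B}"
  proof (rule finite_subset)
    show "{t :: real. t \<in> \<int> \<and> \<bar>t\<bar> \<le> B} \<subseteq> of_int ` {- \<lceil>B\<rceil>..\<lceil>B\<rceil>}"
    proof
      fix t :: real assume "t \<in> {t. t \<in> \<int> \<and> \<bar>t\<bar> \<le> B}"
      then obtain n where "t = of_int n" "\<bar>of_int n\<bar> \<le> B" by (auto elim: Ints_cases)
      then show "t \<in> of_int ` {- \<lceil>B\<rceil>..\<lceil>B\<rceil>}"
        by (intro image_eqI[of _ _ n]) (simp_all, linarith+)
    qed
  qed simp
  \<comment> \<open>The value 0 is added for the coordinates outside \<open>Nd\<close>, which
    \<open>?z\<close> sets to 0.\<close>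
  then have "finite (vec_lambda ` (\<Pi>\<^sub>E (j :: 'n) \<in> UNIV. insert 0 {t :: real. t \<in> \<int> \<and> \<bar>t\<bar> \<le> B}))"
    by (intro finite_imageI finite_PiE) auto
  then have "finite {z :: real^'n. \<forall>j. z $ j \<in> insert 0 {t. t \<in> \<int> \<and> \<bar>t\<bar> \<le> B}}"
    by (rule rev_finite_subset) (auto intro!: image_eqI[where x = "vec_nth z" for z] simp: vec_nth_inverse)
  moreover have "?z ` ?X \<subseteq> {z. \<forall>j. z $ j \<in> insert 0 {t. t \<in> \<int> \<and> \<bar>t\<bar> \<le> B}}"
    using order_trans[OF component_le_norm_cart B]
    by (auto simp: mixed_integer_polyhedron_def)
  ultimately have "finite (?z ` ?X)" by (rule rev_finite_subset)
  define Z where "Z = ?z ` ?X"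
  have fin: "finite Z" unfolding Z_def by fact
  have X: "?X = (\<Union>z\<in>Z. P z)"
    by (auto simp: P_def Z_def mixed_integer_polyhedron_def)
  then have P_subset: "P z \<subseteq> ?X" if "z \<in> Z" for z
    using that by blast
  have "\<exists>F. finite F \<and> P z = convex hull F" if "z \<in> Z" for z
  proof -
    have coord: "polyhedron {x :: real^'n. x $ j = t}" for j t
      using polyhedron_hyperplane[of "axis j 1 :: real^'n" t] by (simp add: inner_axis')
    have "polyhedron (P z)"
      unfolding P_def by (intro polyhedron_Int polyhedron_matrix_le polyhedron_Inter) (auto simp: coord)
    moreover have "bounded (P z)"
      using assms P_subset[OF that] bounded_subset by blast
    ultimately show ?thesis
      using polytope_eq_bounded_polyhedron polytope_def by blast
  qed
  then obtain F where F: "\<And>z. z \<in> Z \<Longrightarrow> finite (F z) \<and> P z = convex hull F z"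
    by metis
  have "convex hull ?X = convex hull (\<Union>z\<in>Z. F z)"
  proof (rule subset_antisym)
    have "P z \<subseteq> convex hull (\<Union>z\<in>Z. F z)" if "z \<in> Z" for z
      using F[OF that] that hull_mono[of "F z" "\<Union>z\<in>Z. F z"] by blast
    then show "convex hull ?X \<subseteq> convex hull (\<Union>z\<in>Z. F z)"
      by (intro hull_minimal convex_convex_hull) (unfold X, blast)
    have "F z \<subseteq> ?X" if "z \<in> Z" for z
      using F[OF that] P_subset[OF that] hull_subset[of "F z" convex] by simp
    then show "convex hull (\<Union>z\<in>Z. F z) \<subseteq> convex hull ?X"
      by (intro hull_mono) blast
  qed
  moreover have "finite (\<Union>z\<in>Z. F z)" using fin F by blast
  ultimately show ?thesis unfolding polytope_def by blast
qed

text \<open>Extreme points of a hull lie among its generators, here finitely many; by Krein-Milman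
  they generate the polytope.\<close>

lemma
  assumes "polytope (convex hull S)"
  shows finite_vert: "finite (vert S)" and convex_hull_vert: "convex hull (vert S) = convex hull S"
proof -
  obtain F where F: "finite F" "convex hull S = convex hull F"
    using assms by (auto simp: polytope_def)
  have "vert S \<subseteq> F"
    unfolding vert_def F(2) by (rule extreme_points_of_convex_hull)
  then show "finite (vert S)" using F(1) finite_subset by blast
  show "convex hull (vert S) = convex hull S"
    unfolding vert_def using Krein_Milman_Minkowski[of "convex hull S"] assms
    by (simp add: polytope_imp_compact)
qed

lemma vert_subset: "vert S \<subseteq> S"
  unfolding vert_def by (rule extreme_points_of_convex_hull)

subsection \<open>The decoupled linear program\<close>

text \<open>The sets \<open>V i\<close> will be the vertices of \<open>X i\<close>, and
  \<open>r\<close> will be \<open>b - \<rho>lim\<close>. Integrality has disappeared: the relaxed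
  problem sees only the hulls of the \<open>V i\<close>.\<close>

locale decoupled_lp =
  fixes c :: "'m::finite \<Rightarrow> real^'n" and A :: "'m \<Rightarrow> real^'n^'p" and r :: "real^'p"
    and V :: "'m \<Rightarrow> (real^'n) set"
  assumes finite_V: "finite (V i)" and V_nonempty: "V i \<noteq> {}"
begin

text \<open>The contribution of agent \<open>i\<close> to the Lagrangian with multiplier
  \<open>l\<close>.\<close>

definition price :: "'m \<Rightarrow> real^'p \<Rightarrow> real^'n \<Rightarrow> real"
  where "price i l v = (c i + l v* A i) \<bullet> v"

definition minimizers :: "'m \<Rightarrow> real^'p \<Rightarrow> (real^'n) set"
  where "minimizers i l = {v \<in> V i. \<forall>w\<in>V i. price i l v \<le> price i l w}"

definition load :: "('m \<Rightarrow> real^'n) \<Rightarrow> real^'p"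
  where "load y = (\<Sum>i\<in>UNIV. A i *v y i)"

definition dual_value :: "real^'p \<Rightarrow> real"
  where "dual_value l = - (l \<bullet> r) + (\<Sum>i\<in>UNIV. Min (price i l ` V i))"

lemma price_eq: "price i l v = c i \<bullet> v + l \<bullet> (A i *v v)"
  by (simp add: price_def inner_add_left dot_lmul_matrix)

lemma minimizers_subset: "minimizers i l \<subseteq> V i"
  by (auto simp: minimizers_def)

lemma finite_minimizers: "finite (minimizers i l)"
  using finite_subset[OF minimizers_subset finite_V] .

lemma minimizers_nonempty: "minimizers i l \<noteq> {}"
proof -
  have "Min (price i l ` V i) \<in> price i l ` V i"
    using finite_V V_nonempty by (intro Min_in) auto
  then obtain v where "v \<in> V i" "Min (price i l ` V i) = price i l v" by auto
  then have "v \<in> minimizers i l"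
    unfolding minimizers_def using finite_V Min_le[of "price i l ` V i"] by fastforce
  then show ?thesis by blast
qed

lemma obtain_minimizers:
  obtains v where "\<And>i. v i \<in> minimizers i l"
proof -
  have "\<exists>v. \<forall>i. v i \<in> minimizers i l"
    using minimizers_nonempty by (intro choice) blast
  then show thesis using that by blast
qed

lemma load_convex_combination:
  "load (\<lambda>i. u *\<^sub>R y i + w *\<^sub>R z i) = u *\<^sub>R load y + w *\<^sub>R load z"
  by (simp add: load_def matrix_vector_right_distrib matrix_vector_mult_scaleR
      scaleR_sum_right sum.distrib)

lemma sum_price: "(\<Sum>i\<in>UNIV. price i l (y i)) = total_cost c y + l \<bullet> load y"
  by (simp add: price_eq total_cost_def load_def sum.distrib inner_sum_right)

lemma price_minimizers_hull:
  assumes "y \<in> convex hull (minimizers i l)"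
  shows "price i l y = Min (price i l ` V i)"
proof -
  have "convex hull (minimizers i l) \<subseteq> {y. (c i + l v* A i) \<bullet> y = Min (price i l ` V i)}"
  proof (intro hull_minimal subsetI)
    fix v assume v: "v \<in> minimizers i l"
    have "Min (price i l ` V i) = price i l v"
      using v finite_V by (intro Min_eqI) (auto simp: minimizers_def)
    then show "v \<in> {y. (c i + l v* A i) \<bullet> y = Min (price i l ` V i)}"
      by (simp add: price_def)
  qed (rule convex_hyperplane)
  then show ?thesis using assms by (auto simp: price_def)
qed

lemma Min_price_le_hull:
  assumes "y \<in> convex hull (V i)"
  shows "Min (price i l ` V i) \<le> price i l y"
proof -
  have "convex hull (V i) \<subseteq> {y. (c i + l v* A i) \<bullet> y \<ge> Min (price i l ` V i)}"
    using finite_V by (intro hull_minimal convex_halfspace_ge) (auto simp flip: price_def)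
  then show ?thesis using assms by (auto simp: price_def)
qed

text \<open>Weak duality: the right-hand side is the Lagrangian at \<open>y\<close> and
  \<open>l\<close>.\<close>

lemma dual_value_le:
  assumes "\<And>i. y i \<in> convex hull (V i)"
  shows "dual_value l \<le> total_cost c y + l \<bullet> (load y - r)"
proof -
  have "(\<Sum>i\<in>UNIV. Min (price i l ` V i)) \<le> (\<Sum>i\<in>UNIV. price i l (y i))"
    by (intro sum_mono Min_price_le_hull assms)
  then show ?thesis by (simp add: dual_value_def sum_price inner_diff_right)
qed

text \<open>The Lagrangian is constant on the hulls of its minimizers. Together with weak duality
  this makes \<open>load y - r\<close> a supergradient of the dual function at
  \<open>l\<close>.\<close>

lemma dual_value_eq:
  assumes "\<And>i. y i \<in> convex hull (minimizers i l)"
  shows "dual_value l = total_cost c y + l \<bullet> (load y - r)"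
proof -
  have "(\<Sum>i\<in>UNIV. Min (price i l ` V i)) = (\<Sum>i\<in>UNIV. price i l (y i))"
    using price_minimizers_hull[OF assms] by simp
  then show ?thesis by (simp add: dual_value_def sum_price inner_diff_right)
qed

text \<open>Finitely many strict price inequalities at \<open>l0\<close> survive, by continuity, in
  a neighbourhood.\<close>

lemma eventually_minimizers_subset:
  "\<forall>\<^sub>F l in nhds l0. \<forall>i. minimizers i l \<subseteq> minimizers i l0"
proof (rule eventually_all_finite)
  fix i
  obtain w where w: "w \<in> minimizers i l0" using minimizers_nonempty by blast
  have "\<forall>\<^sub>F l in nhds l0. \<forall>v\<in>V i - minimizers i l0. price i l w < price i l v"
  proof (rule eventually_ball_finite)
    show "\<forall>v\<in>V i - minimizers i l0. \<forall>\<^sub>F l in nhds l0. price i l w < price i l v"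
    proof
      fix v assume v: "v \<in> V i - minimizers i l0"
      have "price i l0 w < price i l0 v"
        using v w by (auto simp: minimizers_def not_le intro: order_le_less_trans)
      moreover have "((\<lambda>l. price i l v - price i l w) \<longlongrightarrow> price i l0 v - price i l0 w) (nhds l0)"
        unfolding price_eq by (intro tendsto_intros) (rule filterlim_ident)+
      ultimately have "\<forall>\<^sub>F l in nhds l0. 0 < price i l v - price i l w"
        by (intro order_tendstoD(1)) auto
      then show "\<forall>\<^sub>F l in nhds l0. price i l w < price i l v" by simp
    qed
  qed (simp add: finite_V)
  then show "\<forall>\<^sub>F l in nhds l0. minimizers i l \<subseteq> minimizers i l0"
  proof eventually_elim
    case (elim l)
    have w_V: "w \<in> V i" using w minimizers_subset by blast
    show ?case
    proof
      fix v assume "v \<in> minimizers i l"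
      then have "v \<in> V i" "price i l v \<le> price i l w"
        using w_V by (auto simp: minimizers_def)
      then show "v \<in> minimizers i l0" using elim by (metis DiffI leD)
    qed
  qed
qed

lemma continuous_on_load: "continuous_on UNIV load"
  unfolding load_def
  by (intro continuous_intros continuous_on_compose2[OF matrix_vector_mult_linear_continuous_on,
        OF continuous_on_product_coordinates]) auto

end

text \<open>
  Here \<open>l0\<close> is the unique dual solution. The set \<open>balances W\<close> consists of the residuals
  \<open>load y - r\<close>, with \<open>y i\<close> in the convex hull of \<open>W i\<close>, enlarged by all slacks \<open>s\<close> that are
  complementary to \<open>l0\<close>: if \<open>0\<close> is one of its elements and \<open>W i\<close> consists of minimizers at \<open>l0\<close>,
  then \<open>y\<close> satisfies the optimality conditions.
\<close>

locale unique_decoupled_lp = decoupled_lp c A r V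
  for c :: "'m::finite \<Rightarrow> real^'n" and A :: "'m \<Rightarrow> real^'n^'p" and r V +
  fixes l0 :: "real^'p"
  assumes l0_nonneg: "0 \<le> l0"
    and unique_max: "0 \<le> l \<Longrightarrow> l \<noteq> l0 \<Longrightarrow> dual_value l < dual_value l0"
    and unique_min: "is_arg_min (total_cost c) (feasible A r (\<lambda>i. convex hull V i)) y \<Longrightarrow>
      is_arg_min (total_cost c) (feasible A r (\<lambda>i. convex hull V i)) z \<Longrightarrow> y = z"
begin

definition balances :: "('m \<Rightarrow> (real^'n) set) \<Rightarrow> (real^'p) set"
  where "balances W =
    {load y - r + s | y s. (\<forall>i. y i \<in> convex hull (W i)) \<and> 0 \<le> s \<and> l0 \<bullet> s = 0}"

section \<open>Geometry of the balances and optimality conditions\<close>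

lemma convex_balances: "convex (balances W)"
proof (rule convexI)
  fix a b and u w :: real
  assume "a \<in> balances W" "b \<in> balances W" and uw: "0 \<le> u" "0 \<le> w" "u + w = 1"
  then obtain y s z t where
    y: "a = load y - r + s" "\<forall>i. y i \<in> convex hull (W i)" "0 \<le> s" "l0 \<bullet> s = 0" and
    z: "b = load z - r + t" "\<forall>i. z i \<in> convex hull (W i)" "0 \<le> t" "l0 \<bullet> t = 0"
    unfolding balances_def by blast
  have "u *\<^sub>R a + w *\<^sub>R b = load (\<lambda>i. u *\<^sub>R y i + w *\<^sub>R z i) - (u + w) *\<^sub>R r + (u *\<^sub>R s + w *\<^sub>R t)"
    by (simp add: y(1) z(1) load_convex_combination algebra_simps)
  moreover have "u *\<^sub>R y i + w *\<^sub>R z i \<in> convex hull (W i)" for i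
    using y(2) z(2) uw by (intro convexD[OF convex_convex_hull]) auto
  moreover have "0 \<le> u *\<^sub>R s + w *\<^sub>R t" "l0 \<bullet> (u *\<^sub>R s + w *\<^sub>R t) = 0"
    using y(3,4) z(3,4) uw by (auto simp: inner_add_right intro!: add_nonneg_nonneg scaleR_nonneg_nonneg)
  ultimately show "u *\<^sub>R a + w *\<^sub>R b \<in> balances W"
    unfolding balances_def using uw(3) by auto
qed

text \<open>The residuals form a compact set, as a continuous image of a product of polytopes;
  adding the closed cone of slacks keeps the sum closed.\<close>

lemma closed_balances:
  assumes "\<And>i. finite (W i)"
  shows "closed (balances W)"
proof -
  define Y where "Y = (\<Pi>\<^sub>E i\<in>UNIV. convex hull (W i))"
  define S where "S = {s :: real^'p. 0 \<le> s \<and> l0 \<bullet> s = 0}"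
  have "compactin (product_topology (\<lambda>_. euclidean) UNIV) Y"
    unfolding Y_def compactin_PiE using assms by (simp add: finite_imp_compact_convex_hull)
  then have "compact Y" by (simp add: euclidean_product_topology)
  then have "compact ((\<lambda>y. load y - r) ` Y)"
    by (intro compact_continuous_image continuous_intros continuous_on_subset[OF continuous_on_load]) auto
  moreover have "closed S"
  proof -
    have "S = {s. \<forall>j. 0 \<le> s $ j} \<inter> {s. l0 \<bullet> s = 0}"
      by (auto simp: S_def less_eq_vec_def)
    then show ?thesis
      by (auto intro!: closed_Int closed_Collect_all closed_Collect_le closed_hyperplane continuous_intros)
  qed
  ultimately have "closed (\<Union>a\<in>(\<lambda>y. load y - r) ` Y. \<Union>s\<in>S. {a + s})"
    by (rule compact_closed_sums)
  also have "(\<Union>a\<in>(\<lambda>y. load y - r) ` Y. \<Union>s\<in>S. {a + s}) = balances W"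
    by (auto simp: balances_def Y_def S_def PiE_def Pi_def)
  finally show ?thesis .
qed

text \<open>These are the Karush-Kuhn-Tucker conditions: \<open>y\<close> minimizes the Lagrangian
  at \<open>l0\<close> and \<open>s\<close> is its complementary slack. Weak duality compares
  \<open>y\<close> with every feasible \<open>z\<close>.\<close>

lemma optimal_if_balanced:
  assumes y: "\<And>i. y i \<in> convex hull (minimizers i l0)"
    and s: "0 \<le> s" "l0 \<bullet> s = 0" and balance: "load y - r + s = 0"
  shows "is_arg_min (total_cost c) (feasible A r (\<lambda>i. convex hull V i)) y"
proof -
  have yV: "y i \<in> convex hull V i" for i
    using y hull_mono[OF minimizers_subset] by blast
  have load: "load y - r = - s" using balance by (simp add: eq_neg_iff_add_eq_0)
  then have "load y \<le> r" using s(1) by (metis diff_le_0_iff_le neg_le_0_iff_le)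
  moreover have "total_cost c y \<le> total_cost c z"
    if "feasible A r (\<lambda>i. convex hull V i) z" for z
  proof -
    have z: "load z - r \<le> 0" "\<And>i. z i \<in> convex hull (V i)"
      using that by (auto simp: feasible_def load_def)
    have "total_cost c y = dual_value l0"
      using dual_value_eq[OF y] s(2) by (simp add: load)
    also have "\<dots> \<le> total_cost c z + l0 \<bullet> (load z - r)"
      using dual_value_le[OF z(2)] .
    also have "\<dots> \<le> total_cost c z"
    proof -
      have "l0 \<bullet> (load z - r) \<le> 0"
        unfolding inner_vec_def using l0_nonneg z(1)
        by (intro sum_nonpos) (simp add: less_eq_vec_def mult_nonneg_nonpos)
      then show ?thesis by simp
    qed
    finally show ?thesis .
  qed
  ultimately show ?thesis
    using yV by (auto simp: is_arg_min_linorder feasible_def load_def)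
qed

lemma load_mem_balances:
  assumes "\<And>i. y i \<in> W i" shows "load y - r \<in> balances W"
  unfolding balances_def using assms
  by (auto intro!: exI[of _ y] exI[of _ 0] hull_inc)

text \<open>Nonnegative multiples of the \<open>j\<close>-th unit vector are complementary slacks,
  so a negative \<open>h $ j\<close> would make \<open>h\<close> unbounded below on the
  balances.\<close>

lemma nonneg_component_if_nonneg_on_balances:
  assumes W: "\<And>i. W i \<noteq> {}" and h: "\<And>a. a \<in> balances W \<Longrightarrow> 0 \<le> h \<bullet> a" and j: "l0 $ j = 0"
  shows "0 \<le> h $ j"
proof (rule ccontr)
  assume neg: "\<not> 0 \<le> h $ j"
  have "\<exists>v. \<forall>i. v i \<in> W i" using W by (intro choice) blast
  then obtain v where v: "\<And>i. v i \<in> W i" by blast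
  \<comment> \<open>Chosen so that \<open>h\<close> takes the value -1 at the shifted
    residual.\<close>
  define t where "t = (h \<bullet> (load v - r) + 1) / - h $ j"
  have "0 \<le> h \<bullet> (load v - r)" by (intro h load_mem_balances v)
  then have "t \<ge> 0" using neg unfolding t_def by (intro divide_nonneg_pos) auto
  then have "0 \<le> t *\<^sub>R axis j (1::real)" by (auto simp: less_eq_vec_def axis_def)
  moreover have "l0 \<bullet> (t *\<^sub>R axis j 1) = 0" using j by (simp add: inner_axis)
  ultimately have "load v - r + t *\<^sub>R axis j 1 \<in> balances W"
    unfolding balances_def using v by (blast intro: hull_inc)
  then have "0 \<le> h \<bullet> (load v - r) + t * h $ j"
    using h by (force simp: inner_add_right inner_axis)
  moreover have "t * h $ j = - (h \<bullet> (load v - r) + 1)"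
    using neg by (simp add: t_def)
  ultimately show False by simp
qed

text \<open>
  A nonzero \<open>h\<close> that is nonnegative on \<open>balances\<close> would be an admissible direction at \<open>l0\<close> in
  which the dual function does not decrease.
\<close>

lemma zero_interior_balances: "0 \<in> interior (balances (\<lambda>i. minimizers i l0))"
proof (rule ccontr)
  assume "\<not> ?thesis"
  then obtain h where h: "h \<noteq> 0" "\<And>y. y \<in> balances (\<lambda>i. minimizers i l0) \<Longrightarrow> 0 \<le> h \<bullet> y"
    using nonneg_functional_if_not_interior[OF convex_balances] by metis
  have h_load: "0 \<le> h \<bullet> (load y - r)" if "\<And>i. y i \<in> minimizers i l0" for y
    by (intro h(2) load_mem_balances that)
  have h_nonneg: "0 \<le> h $ j" if "l0 $ j = 0" for j
    using nonneg_component_if_nonneg_on_balances[OF minimizers_nonempty h(2) that] .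
  have lim: "((\<lambda>t. l0 + t *\<^sub>R h) \<longlongrightarrow> l0) (at_right 0)"
    by (auto intro!: tendsto_eq_intros)
  \<comment> \<open>Zero components of \<open>l0\<close> cannot decrease along \<open>h\<close>, and
    positive ones stay positive for small \<open>t\<close>.\<close>
  have "\<forall>\<^sub>F t in at_right 0. \<forall>j. 0 \<le> (l0 + t *\<^sub>R h) $ j"
  proof (rule eventually_all_finite)
    fix j
    show "\<forall>\<^sub>F t in at_right 0. 0 \<le> (l0 + t *\<^sub>R h) $ j"
    proof (cases "l0 $ j = 0")
      case True
      then show ?thesis
        using h_nonneg[of j] by (auto simp: eventually_at_right_less eventually_at_filter)
    next
      case False
      then have "0 < l0 $ j" using l0_nonneg by (simp add: less_eq_vec_def order_le_neq_trans)
      then have "\<forall>\<^sub>F t in at_right 0. 0 < (l0 + t *\<^sub>R h) $ j"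
        by (intro order_tendstoD(1)[OF tendsto_vec_nth[OF lim]])
      then show ?thesis by (rule eventually_mono) simp
    qed
  qed
  moreover have "\<forall>\<^sub>F t in at_right 0. \<forall>i. minimizers i (l0 + t *\<^sub>R h) \<subseteq> minimizers i l0"
    using lim eventually_minimizers_subset by (rule eventually_compose_filterlim[rotated])
  moreover have "\<forall>\<^sub>F t in at_right (0::real). 0 < t"
    by (rule eventually_at_right_less)
  ultimately have "\<forall>\<^sub>F t in at_right 0. (\<forall>j. 0 \<le> (l0 + t *\<^sub>R h) $ j) \<and>
      (\<forall>i. minimizers i (l0 + t *\<^sub>R h) \<subseteq> minimizers i l0) \<and> 0 < t"
    by (intro eventually_conj)
  then obtain t where t: "0 \<le> l0 + t *\<^sub>R h" "0 < t"
    "\<And>i. minimizers i (l0 + t *\<^sub>R h) \<subseteq> minimizers i l0"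
    using eventually_happens'[OF trivial_limit_at_right_real] unfolding less_eq_vec_def
    by (metis (mono_tags, lifting) zero_index)
  \<comment> \<open>The same \<open>w\<close> is optimal at both multipliers, so the dual values
    differ by exactly \<open>t\<close> times the nonnegative slope
    \<open>h \<bullet> (load w - r)\<close>.\<close>
  obtain w where w: "\<And>i. w i \<in> minimizers i (l0 + t *\<^sub>R h)"
    using obtain_minimizers[of "l0 + t *\<^sub>R h"] by blast
  have w0: "w i \<in> minimizers i l0" for i using w t(3) by blast
  have "dual_value (l0 + t *\<^sub>R h) = dual_value l0 + t * (h \<bullet> (load w - r))"
    using dual_value_eq[of w "l0 + t *\<^sub>R h"] dual_value_eq[of w l0] w w0
    by (simp add: hull_inc inner_add_left)
  then have "dual_value l0 \<le> dual_value (l0 + t *\<^sub>R h)"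
    using h_load[OF w0] t(2) by simp
  then show False using unique_max[OF t(1)] t(2) h(1) by auto
qed

text \<open>A ball of radius \<open>\<kappa>\<close> in the balances supplies a supergradient at
  \<open>l0\<close> with slope at most \<open>- \<kappa>\<close> towards \<open>l\<close>. By
  concavity, supergradients at \<open>l\<close> have no larger slope in that direction.\<close>

lemma sharp_maximum:
  obtains \<kappa> where "\<kappa> > 0"
    "\<And>l y. 0 \<le> l \<Longrightarrow> (\<And>i. y i \<in> minimizers i l) \<Longrightarrow>
      (load y - r) \<bullet> (l - l0) \<le> - \<kappa> * norm (l - l0)"
proof -
  obtain \<kappa> where \<kappa>: "\<kappa> > 0" "cball 0 \<kappa> \<subseteq> balances (\<lambda>i. minimizers i l0)"
    using zero_interior_balances by (auto simp: mem_interior_cball)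
  have "(load y - r) \<bullet> (l - l0) \<le> - \<kappa> * norm (l - l0)"
    if l: "0 \<le> l" and y: "\<And>i. y i \<in> minimizers i l" for l y
  proof -
    let ?h = "l - l0"
    have "- \<kappa> *\<^sub>R sgn ?h \<in> balances (\<lambda>i. minimizers i l0)"
      using \<kappa> by (intro subsetD[OF \<kappa>(2)]) (simp add: norm_sgn)
    then obtain z s where zs: "- \<kappa> *\<^sub>R sgn ?h = load z - r + s"
      "\<And>i. z i \<in> convex hull minimizers i l0" "0 \<le> s" "l0 \<bullet> s = 0"
      unfolding balances_def by blast
    \<comment> \<open>The slack is orthogonal to \<open>l0\<close>, so it can only increase the
      product with \<open>?h\<close> and may be dropped.\<close>
    have "0 \<le> l \<bullet> s"
      using l zs(3) by (auto simp: inner_vec_def less_eq_vec_def intro!: sum_nonneg)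
    then have "0 \<le> s \<bullet> ?h" using zs(4) by (simp add: inner_diff_right inner_commute)
    then have "(load z - r) \<bullet> ?h \<le> (load z - r + s) \<bullet> ?h"
      unfolding inner_add_left by simp
    also have "\<dots> = (- \<kappa> *\<^sub>R sgn ?h) \<bullet> ?h" unfolding zs(1) ..
    also have "\<dots> = - \<kappa> * norm ?h"
      by (cases "l = l0") (simp_all add: sgn_div_norm dot_square_norm power2_eq_square)
    finally have z_le: "(load z - r) \<bullet> ?h \<le> - \<kappa> * norm ?h" .
    have "dual_value l \<le> total_cost c z + l \<bullet> (load z - r)"
      using zs(2) hull_mono[OF minimizers_subset] by (intro dual_value_le) blast
    also have "\<dots> = dual_value l0 + (load z - r) \<bullet> ?h"
      using dual_value_eq[OF zs(2)] by (simp add: inner_commute inner_diff_right inner_diff_left)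
    finally have up: "dual_value l \<le> dual_value l0 + (load z - r) \<bullet> ?h" .
    have "dual_value l0 \<le> total_cost c y + l0 \<bullet> (load y - r)"
      using y minimizers_subset by (intro dual_value_le hull_inc) blast
    also have "\<dots> = dual_value l - (load y - r) \<bullet> ?h"
      using dual_value_eq[of y l] y
      by (simp add: hull_inc inner_commute inner_diff_right inner_diff_left)
    finally show ?thesis using up z_le by simp
  qed
  then show thesis using that \<kappa>(1) by blast
qed

text \<open>
  Since \<open>0\<close> is interior, the solution can be written as a proper convex combination in which
  every minimizer gets positive weight. It can therefore be moved along all the edges
  \<open>v i - w i\<close>, and if there are more than \<open>p\<close> of them, some nontrivial move preserves the load.
\<close>

lemma card_multiple_minimizers:
  "card {i. \<exists>v w. v \<in> minimizers i l0 \<and> w \<in> minimizers i l0 \<and> v \<noteq> w} \<le> CARD('p)"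
proof (rule ccontr)
  define I where "I = {i. \<exists>v w. v \<in> minimizers i l0 \<and> w \<in> minimizers i l0 \<and> v \<noteq> w}"
  assume "\<not> ?thesis"
  then have "DIM(real^'p) < card I" by (simp add: I_def)
  obtain v w where vw: "\<And>i. v i \<in> minimizers i l0" "\<And>i. w i \<in> minimizers i l0"
    "\<And>i. i \<in> I \<Longrightarrow> v i \<noteq> w i"
  proof -
    have "\<exists>v w. v \<in> minimizers i l0 \<and> w \<in> minimizers i l0 \<and> (i \<in> I \<longrightarrow> v \<noteq> w)" for i
      using minimizers_nonempty[of i l0] by (auto simp: I_def)
    then show thesis using that by metis
  qed
  obtain t where t: "\<exists>i\<in>I. t i \<noteq> (0::real)" "(\<Sum>i\<in>I. t i *\<^sub>R (A i *v (v i - w i))) = 0"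
    using ex_linear_dependence[OF _ \<open>DIM(real^'p) < card I\<close>, of "\<lambda>i. A i *v (v i - w i)"] by auto
  define e where "e i = (if i \<in> I then t i else 0) *\<^sub>R (v i - w i)" for i
  have "load e = (\<Sum>i\<in>I. t i *\<^sub>R (A i *v (v i - w i)))"
    unfolding load_def e_def
    by (intro sum.mono_neutral_cong_right) (auto simp: matrix_vector_mult_scaleR)
  then have load_e: "load e = 0" using t(2) by simp
  \<comment> \<open>Midpoints leave room to move in both directions along the edges.\<close>
  define z where "z i = (1/2) *\<^sub>R v i + (1/2) *\<^sub>R w i" for i
  obtain \<kappa> where \<kappa>: "\<kappa> > 0" "cball 0 \<kappa> \<subseteq> balances (\<lambda>i. minimizers i l0)"
    using zero_interior_balances by (auto simp: mem_interior_cball)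
  define N where "N = norm (load z - r) + 1"
  have "N > 0" by (simp add: N_def add_nonneg_pos)
  \<comment> \<open>With this weight the residual of \<open>z\<close> cancels against that of the
    point \<open>y\<close> below, whose residual plus slack is \<open>- (\<kappa> / N)\<close> times
    the residual of \<open>z\<close>.\<close>
  define \<theta> where "\<theta> = \<kappa> / (N + \<kappa>)"
  have \<theta>: "0 < \<theta>" "\<theta> < 1" and \<theta>_ratio: "\<theta> * N = (1 - \<theta>) * \<kappa>"
    using \<open>N > 0\<close> \<kappa>(1) by (auto simp: \<theta>_def field_simps)
  have "- (\<kappa> / N) *\<^sub>R (load z - r) \<in> balances (\<lambda>i. minimizers i l0)"
  proof (rule subsetD[OF \<kappa>(2)])
    have "norm (- (\<kappa> / N) *\<^sub>R (load z - r)) = \<kappa> * (norm (load z - r) / N)"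
      unfolding norm_scaleR using \<kappa>(1) \<open>N > 0\<close> by simp
    also have "\<dots> \<le> \<kappa> * 1"
      using \<kappa>(1) \<open>N > 0\<close> by (intro mult_left_mono) (auto simp: N_def)
    finally show "- (\<kappa> / N) *\<^sub>R (load z - r) \<in> cball 0 \<kappa>" by simp
  qed
  then obtain y s where ys: "- (\<kappa> / N) *\<^sub>R (load z - r) = load y - r + s"
    "\<And>i. y i \<in> convex hull minimizers i l0" "0 \<le> s" "l0 \<bullet> s = 0"
    unfolding balances_def by blast
  \<comment> \<open>Small enough that the weights of \<open>v i\<close> and \<open>w i\<close>, each
    \<open>\<theta> / 2\<close> in the mixture, stay nonnegative after the move.\<close>
  obtain \<mu> where \<mu>: "\<mu> > 0" "\<And>i. \<mu> * \<bar>t i\<bar> \<le> \<theta> / 2"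
  proof -
    define M where "M = (\<Sum>i\<in>UNIV. \<bar>t i\<bar>) + 1"
    have le: "\<bar>t i\<bar> \<le> M" for i
      using member_le_sum[of i UNIV "\<lambda>i. \<bar>t i\<bar>"] by (simp add: M_def)
    have "M > 0" by (simp add: M_def add_nonneg_pos sum_nonneg)
    show thesis
    proof (rule that[of "\<theta> / (2 * M)"])
      show "\<theta> / (2 * M) > 0" using \<theta> \<open>M > 0\<close> by simp
      show "\<theta> / (2 * M) * \<bar>t i\<bar> \<le> \<theta> / 2" for i
        using \<theta> \<open>M > 0\<close> le[of i] by (simp add: field_simps)
    qed
  qed
  define X where "X \<sigma> i = (1 - \<theta>) *\<^sub>R y i + \<theta> *\<^sub>R z i + \<sigma> *\<^sub>R e i" for \<sigma> i
  have X_hull: "X \<sigma> i \<in> convex hull minimizers i l0" if "\<bar>\<sigma>\<bar> \<le> \<mu>" for \<sigma> i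
  proof -
    define \<tau> where "\<tau> = \<sigma> * (if i \<in> I then t i else 0)"
    have "\<bar>\<tau>\<bar> \<le> \<mu> * \<bar>t i\<bar>"
      unfolding \<tau>_def using that \<mu>(1) by (auto simp: abs_mult intro: mult_right_mono)
    then have \<tau>: "\<bar>\<tau>\<bar> \<le> \<theta> / 2" using \<mu>(2)[of i] by simp
    have "X \<sigma> i = (1 - \<theta>) *\<^sub>R y i + \<theta> *\<^sub>R ((1/2 + \<tau> / \<theta>) *\<^sub>R v i + (1/2 - \<tau> / \<theta>) *\<^sub>R w i)"
      using \<theta>(1) by (simp add: X_def z_def e_def \<tau>_def algebra_simps)
    moreover have "\<bar>\<tau> / \<theta>\<bar> \<le> 1/2" using \<tau> \<theta>(1) by (simp add: field_simps)
    then have "0 \<le> 1/2 + \<tau> / \<theta>" "0 \<le> 1/2 - \<tau> / \<theta>" by linarith+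
    then have "(1/2 + \<tau> / \<theta>) *\<^sub>R v i + (1/2 - \<tau> / \<theta>) *\<^sub>R w i \<in> convex hull minimizers i l0"
      using vw(1,2) by (intro convexD[OF convex_convex_hull] hull_inc) auto
    ultimately show ?thesis
      using ys(2) \<theta> by (auto intro!: convexD[OF convex_convex_hull])
  qed
  have "load (X \<sigma>) - r + (1 - \<theta>) *\<^sub>R s = 0" for \<sigma>
  proof -
    have "load (X \<sigma>) = (1 - \<theta>) *\<^sub>R load y + \<theta> *\<^sub>R load z"
      using load_convex_combination[of 1 "\<lambda>i. (1 - \<theta>) *\<^sub>R y i + \<theta> *\<^sub>R z i" \<sigma> e]
      by (simp add: X_def[abs_def] load_e load_convex_combination)
    then have "load (X \<sigma>) - r + (1 - \<theta>) *\<^sub>R s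
        = (1 - \<theta>) *\<^sub>R (load y - r + s) + \<theta> *\<^sub>R (load z - r)"
      by (simp add: algebra_simps)
    also have "\<dots> = (\<theta> - (1 - \<theta>) * (\<kappa> / N)) *\<^sub>R (load z - r)"
      unfolding ys(1)[symmetric] by (simp add: algebra_simps)
    also have "\<theta> - (1 - \<theta>) * (\<kappa> / N) = 0"
      using \<theta>_ratio \<open>N > 0\<close> by (simp add: field_simps)
    finally show ?thesis by simp
  qed
  then have "is_arg_min (total_cost c) (feasible A r (\<lambda>i. convex hull V i)) (X \<sigma>)"
    if "\<bar>\<sigma>\<bar> \<le> \<mu>" for \<sigma>
    using X_hull[OF that] \<theta> ys(3,4)
    by (intro optimal_if_balanced[of _ "(1 - \<theta>) *\<^sub>R s"]) (auto intro: scaleR_nonneg_nonneg)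
  then have "X 0 = X \<mu>" using unique_min \<mu>(1) by simp
  moreover obtain i where i: "i \<in> I" "t i \<noteq> 0" using t(1) by blast
  ultimately have "\<mu> *\<^sub>R e i = 0" by (auto simp: X_def dest: fun_cong[of _ _ i])
  then show False using \<mu>(1) i vw(3)[of i] by (simp add: e_def)
qed

section \<open>Projected supergradient ascent with a fixed right-hand side\<close>

context
  fixes \<alpha> :: "nat \<Rightarrow> real" and lam :: "nat \<Rightarrow> real^'p" and y :: "nat \<Rightarrow> 'm \<Rightarrow> real^'n"
  assumes steps: "step_sizes \<alpha>"
    and lam_nonneg: "\<And>k. 0 \<le> lam k"
    and y: "\<And>k i. y k i \<in> minimizers i (lam k)"
    and lam_Suc: "\<And>k. lam (Suc k) = orthant_proj (lam k + \<alpha> k *\<^sub>R (load (y k) - r))"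
begin

text \<open>Projection does not increase the distance to \<open>l0\<close>; expanding the square and
  inserting the sharp maximum gives the recursion of
  \<open>sharp_descent_tendsto_zero\<close>.\<close>

lemma ascent_tendsto: "lam \<longlonglongrightarrow> l0"
proof -
  obtain \<kappa> where \<kappa>: "\<kappa> > 0" "\<And>l y. 0 \<le> l \<Longrightarrow> (\<And>i. y i \<in> minimizers i l) \<Longrightarrow>
      (load y - r) \<bullet> (l - l0) \<le> - \<kappa> * norm (l - l0)"
    using sharp_maximum by blast
  define G where "G = (\<Sum>i\<in>UNIV. \<Sum>v\<in>V i. norm (A i *v v)) + norm r + 1"
  have "G > 0" by (simp add: G_def add_nonneg_pos sum_nonneg)
  have G: "norm (load (y k) - r) \<le> G" for k
  proof -
    have "norm (load (y k)) \<le> (\<Sum>i\<in>UNIV. norm (A i *v y k i))"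
      unfolding load_def by (rule norm_sum)
    also have "\<dots> \<le> (\<Sum>i\<in>UNIV. \<Sum>v\<in>V i. norm (A i *v v))"
      by (intro sum_mono member_le_sum subsetD[OF minimizers_subset y] finite_V norm_ge_zero)
    finally show ?thesis
      using norm_triangle_ineq4[of "load (y k)" r] by (simp add: G_def)
  qed
  have norm_expand: "(norm (u + t *\<^sub>R g))\<^sup>2 = (norm u)\<^sup>2 + 2 * t * (g \<bullet> u) + (t * norm g)\<^sup>2"
    for u g :: "real^'p" and t
    unfolding power_mult_distrib power2_norm_eq_inner
    by (simp add: inner_add_left inner_add_right inner_commute power2_eq_square algebra_simps)
  have "(norm (lam (Suc k) - l0))\<^sup>2 \<le> (norm (lam k - l0))\<^sup>2
      - 2 * \<kappa> * \<alpha> k * norm (lam k - l0) + (\<alpha> k * G)\<^sup>2" for k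
  proof -
    let ?g = "load (y k) - r"
    have \<alpha>: "\<alpha> k > 0" using steps by (simp add: step_sizes_def)
    have "(norm (lam (Suc k) - l0))\<^sup>2 \<le> (norm ((lam k + \<alpha> k *\<^sub>R ?g) - l0))\<^sup>2"
      unfolding lam_Suc by (intro power_mono norm_orthant_proj_diff_le l0_nonneg) simp
    also have "(lam k + \<alpha> k *\<^sub>R ?g) - l0 = (lam k - l0) + \<alpha> k *\<^sub>R ?g" by simp
    also have "(norm \<dots>)\<^sup>2 = (norm (lam k - l0))\<^sup>2 + 2 * \<alpha> k * (?g \<bullet> (lam k - l0)) + (\<alpha> k * norm ?g)\<^sup>2"
      by (rule norm_expand)
    also have "\<dots> \<le> (norm (lam k - l0))\<^sup>2 + 2 * \<alpha> k * (- \<kappa> * norm (lam k - l0)) + (\<alpha> k * G)\<^sup>2"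
      using \<alpha> \<kappa>(2)[OF lam_nonneg[of k] y] G[of k]
      by (intro add_mono mult_left_mono power_mono order_refl) auto
    finally show ?thesis by (simp add: algebra_simps)
  qed
  then have "(\<lambda>k. norm (lam k - l0)) \<longlonglongrightarrow> 0"
    by (intro sharp_descent_tendsto_zero[OF steps \<kappa>(1) \<open>G > 0\<close>]) auto
  then show ?thesis by (simp add: tendsto_norm_zero_iff LIM_zero_iff)
qed

text \<open>
  The points generated late balance the LP: a hyperplane strictly separating their residuals from
  \<open>0\<close> would have a normal vector along which the multipliers increase without bound.
\<close>

lemma ascent_primal:
  obtains z where "is_arg_min (total_cost c) (feasible A r (\<lambda>i. convex hull V i)) z"
    "\<And>i. z i \<in> convex hull range (\<lambda>k. y k i)"
    "\<forall>\<^sub>F k in sequentially. card {i. y k i \<noteq> z i} \<le> CARD('p)"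
proof -
  \<comment> \<open>In these components the projection eventually stops clipping.\<close>
  have "\<forall>\<^sub>F k in sequentially. \<forall>j. 0 < l0 $ j \<longrightarrow> 0 < lam k $ j"
  proof (rule eventually_all_finite)
    show "\<forall>\<^sub>F k in sequentially. 0 < l0 $ j \<longrightarrow> 0 < lam k $ j" for j
      using order_tendstoD(1)[OF tendsto_vec_nth[OF ascent_tendsto]]
      by (cases "0 < l0 $ j") auto
  qed
  moreover have "\<forall>\<^sub>F k in sequentially. \<forall>i. minimizers i (lam k) \<subseteq> minimizers i l0"
    using eventually_minimizers_subset ascent_tendsto by (rule eventually_compose_filterlim)
  ultimately obtain K where pos: "\<And>k j. k \<ge> K \<Longrightarrow> 0 < l0 $ j \<Longrightarrow> 0 < lam k $ j"
    and "\<And>k i. k \<ge> K \<Longrightarrow> minimizers i (lam k) \<subseteq> minimizers i l0"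
    unfolding eventually_sequentially by (metis nle_le order_trans)
  then have y0: "y k i \<in> minimizers i l0" if "k \<ge> K" for k i
    using y that by blast
  define W where "W i = (\<lambda>k. y k i) ` {K..}" for i
  have W_subset: "W i \<subseteq> minimizers i l0" for i
    using y0 by (auto simp: W_def)
  have y_balance: "load (y k) - r \<in> balances W" if "k \<ge> K" for k
    using that by (intro load_mem_balances) (auto simp: W_def)
  have "0 \<in> balances W"
  proof (rule ccontr)
    assume "0 \<notin> balances W"
    moreover have "closed (balances W)"
      using W_subset finite_minimizers finite_subset by (intro closed_balances) blast
    ultimately obtain h \<beta> where h: "\<beta> > 0" "\<And>a. a \<in> balances W \<Longrightarrow> \<beta> < h \<bullet> a"
      using separating_hyperplane_closed_0[OF convex_balances] by metis
    have h_nonneg: "0 \<le> h $ j" if "l0 $ j = 0" for j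
    proof (rule nonneg_component_if_nonneg_on_balances[OF _ _ that])
      show "W i \<noteq> {}" for i by (auto simp: W_def)
      show "0 \<le> h \<bullet> a" if "a \<in> balances W" for a using h(1) h(2)[OF that] by simp
    qed
    have "h \<bullet> lam k + \<beta> * \<alpha> k \<le> h \<bullet> lam (Suc k)" if k: "k \<ge> K" for k
    proof -
      let ?u = "lam k + \<alpha> k *\<^sub>R (load (y k) - r)"
      have \<alpha>: "\<alpha> k > 0" using steps by (simp add: step_sizes_def)
      \<comment> \<open>Clipping can only raise a component, and from \<open>K\<close> on it occurs
        only where \<open>l0 $ j = 0\<close> and hence \<open>h $ j \<ge> 0\<close>.\<close>
      have "h $ j * ?u $ j \<le> h $ j * lam (Suc k) $ j" for j
      proof (cases "l0 $ j = 0")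
        case True
        then show ?thesis
          using h_nonneg unfolding lam_Suc orthant_proj_eq by (intro mult_left_mono) auto
      next
        case False
        then have "0 < l0 $ j" using l0_nonneg by (simp add: less_eq_vec_def order_le_neq_trans)
        then have "0 < lam (Suc k) $ j" using pos[of "Suc k"] k by simp
        then have "lam (Suc k) $ j = ?u $ j" unfolding lam_Suc orthant_proj_eq by (simp add: max_def split: if_splits)
        then show ?thesis by simp
      qed
      then have "h \<bullet> ?u \<le> h \<bullet> lam (Suc k)"
        unfolding inner_vec_def by (intro sum_mono) (simp add: inner_real_def)
      moreover have "\<beta> * \<alpha> k \<le> \<alpha> k * (h \<bullet> (load (y k) - r))"
        using h(2)[OF y_balance[OF k]] \<alpha> by (simp add: mult.commute)
      ultimately show ?thesis by (simp add: inner_add_right)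
    qed
    then have "filterlim (\<lambda>k. h \<bullet> lam k) at_top sequentially"
      using filterlim_at_top_increments[of \<alpha> \<beta> K "\<lambda>k. h \<bullet> lam k"] steps h(1)
      by (simp add: step_sizes_def)
    from filterlim_at_top_imp_at_infinity[OF this] show False
      by (rule not_tendsto_and_filterlim_at_infinity[rotated 2])
        (auto intro: tendsto_inner ascent_tendsto)
  qed
  then obtain z s where z: "\<And>i. z i \<in> convex hull (W i)" "0 \<le> s" "l0 \<bullet> s = 0" "load z - r + s = 0"
    unfolding balances_def by (smt (verit) mem_Collect_eq)
  have z_min: "z i \<in> convex hull (minimizers i l0)" for i
    using z(1) hull_mono[OF W_subset] by blast
  show thesis
  proof
    show "is_arg_min (total_cost c) (feasible A r (\<lambda>i. convex hull V i)) z"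
      using z_min z(2-4) by (rule optimal_if_balanced)
    show "z i \<in> convex hull range (\<lambda>k. y k i)" for i
      using z(1)[of i] hull_mono[of "W i" "range (\<lambda>k. y k i)"] by (auto simp: W_def)
    \<comment> \<open>An agent with a single minimizer at \<open>l0\<close> has both
      \<open>y k i\<close> and \<open>z i\<close> equal to it.\<close>
    have "card {i. y k i \<noteq> z i} \<le> CARD('p)" if k: "k \<ge> K" for k
    proof (rule order_trans[OF card_mono card_multiple_minimizers])
      show "{i. y k i \<noteq> z i} \<subseteq>
        {i. \<exists>v w. v \<in> minimizers i l0 \<and> w \<in> minimizers i l0 \<and> v \<noteq> w}"
      proof (rule subsetI, rule ccontr)
        fix i assume i: "i \<in> {i. y k i \<noteq> z i}"
          "i \<notin> {i. \<exists>v w. v \<in> minimizers i l0 \<and> w \<in> minimizers i l0 \<and> v \<noteq> w}"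
        then have "minimizers i l0 = {y k i}" using y0[OF k, of i] by blast
        then show False using z_min[of i] i(1) by simp
      qed
    qed simp
    then show "\<forall>\<^sub>F k in sequentially. card {i. y k i \<noteq> z i} \<le> CARD('p)"
      by (auto simp: eventually_sequentially)
  qed
qed

end

end

subsection \<open>The algorithm\<close>

text \<open>Allows a restart after \<open>N\<close> iterations: the partial sums change only by a
  constant.\<close>

lemma step_sizes_shift:
  assumes "step_sizes \<alpha>" shows "step_sizes (\<lambda>k. \<alpha> (k + N))"
proof -
  have sum: "(\<Sum>k<n. \<alpha> (k + N)) = - (\<Sum>k<N. \<alpha> k) + (\<Sum>k<n + N. \<alpha> k)" for n
    by (induction n) (auto simp: add.commute)
  have "filterlim (\<lambda>n. \<Sum>k<n + N. \<alpha> k) at_top sequentially"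
    using assms filterlim_compose[OF _ filterlim_add_const_nat_at_top]
    unfolding step_sizes_def by blast
  then have "filterlim (\<lambda>n. \<Sum>k<n. \<alpha> (k + N)) at_top sequentially"
    unfolding sum by (intro filterlim_tendsto_add_at_top[OF tendsto_const])
  then show ?thesis
    using assms by (auto simp: step_sizes_def intro: LIMSEQ_ignore_initial_segment)
qed

text \<open>The infinite initial value is absorbed by the first step; \<open>f k\<close> enters at
  index \<open>Suc k\<close>.\<close>

lemma running_max_eq:
  assumes "s 0 = - \<infinity>" "\<And>k. s (Suc k) = max (s k) (ereal (f k))"
  shows "s (Suc k) = ereal (Max (f ` {..k}))"
proof (induction k)
  case (Suc k)
  then show ?case
    by (subst assms(2)) (simp add: atMost_Suc max.commute)
qed (simp add: assms)

lemma running_min_eq: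
  assumes "s 0 = \<infinity>" "\<And>k. s (Suc k) = min (s k) (ereal (f k))"
  shows "s (Suc k) = ereal (Min (f ` {..k}))"
proof (induction k)
  case (Suc k)
  then show ?case
    by (subst assms(2)) (simp add: atMost_Suc min.commute)
qed (simp add: assms)

text \<open>Finitely many indices realize all values; every \<open>k\<close> beyond them has seen
  the whole range.\<close>

lemma eventually_image_atMost_eq_range:
  fixes f :: "nat \<Rightarrow> 'a"
  assumes "finite (range f)"
  shows "\<forall>\<^sub>F k in sequentially. f ` {..k} = range f"
proof -
  obtain C where C: "finite C" "range f = f ` C"
    using finite_subset_image[OF assms subset_refl] by blast
  then obtain N where "C \<subseteq> {..N}"
    by (auto simp: finite_nat_set_iff_bounded_le)
  then have "C \<subseteq> {..k}" if "k \<ge> N" for k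
    using that by (meson atMost_subset_iff order_trans)
  then have "f ` {..k} = range f" if "k \<ge> N" for k
    using C(2) that by blast
  then show ?thesis by (auto simp: eventually_sequentially)
qed

theorem theorem3:
  fixes c :: "'m::finite \<Rightarrow> real^'n"
    and A :: "'m \<Rightarrow> real^'n^'p"
    and b :: "real^'p"
    and Nc Nd :: "'m \<Rightarrow> 'n set"
    and D :: "'m \<Rightarrow> real^'n^'q"
    and d :: "'m \<Rightarrow> real^'q"
    and X :: "'m \<Rightarrow> (real^'n) set"
    and \<alpha> :: "nat \<Rightarrow> real"
    and sel :: "'m \<Rightarrow> real^'p \<Rightarrow> real^'n"
    and x :: "nat \<Rightarrow> 'm \<Rightarrow> real^'n"
    and smax smin :: "nat \<Rightarrow> 'm \<Rightarrow> 'p \<Rightarrow> ereal"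
    and \<rho>i :: "nat \<Rightarrow> 'm \<Rightarrow> real^'p"
    and \<rho> lam :: "nat \<Rightarrow> real^'p"
  assumes coordinates: "\<And>i. Nc i \<inter> Nd i = {}"
    and X: "\<And>i. X i = mixed_integer_polyhedron (Nc i) (Nd i) (D i) (d i)"
    and nonempty: "\<And>i. X i \<noteq> {}"
    and steps: "step_sizes \<alpha>"
    and rule: "minimizer_rule c A X sel"
    and run: "generated_by_algorithm c A b \<alpha> sel x smax smin \<rho>i \<rho> lam"
    and boundedness: "\<And>i. bounded (X i)"
    and unique_primal: "\<exists>!xLP. lp_solution c A b X (lim \<rho>) xLP"
    and unique_dual: "\<exists>!l. dual_solution c A b X (lim \<rho>) l"
  shows "\<exists>K. \<forall>k\<ge>K. feasible A b X (x k)"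
proof -
  have lam_0: "lam 0 = 0" and smax_0: "\<And>i j. smax 0 i j = - \<infinity>" and smin_0: "\<And>i j. smin 0 i j = \<infinity>"
    and x_Suc: "\<And>k i. x (Suc k) i = sel i (lam k)"
    and smax_Suc: "\<And>k i j. smax (Suc k) i j = max (smax k i j) (ereal ((A i *v x (Suc k) i) $ j))"
    and smin_Suc: "\<And>k i j. smin (Suc k) i j = min (smin k i j) (ereal ((A i *v x (Suc k) i) $ j))"
    and \<rho>i_Suc: "\<And>k i. \<rho>i (Suc k) i = (\<chi> j. real_of_ereal (smax (Suc k) i j - smin (Suc k) i j))"
    and \<rho>_Suc: "\<And>k. \<rho> (Suc k) = (\<chi> j. real CARD('p) * (MAX i. \<rho>i (Suc k) i $ j))"
    and lam_Suc: "\<And>k. lam (Suc k) =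
        orthant_proj (lam k + \<alpha> k *\<^sub>R ((\<Sum>i\<in>UNIV. A i *v x (Suc k) i) - b + \<rho> (Suc k)))"
    using run unfolding generated_by_algorithm_def by blast+
  have poly: "polytope (convex hull X i)" for i
    unfolding X using boundedness[of i] unfolding X by (rule mixed_integer_convex_hull_polytope)
  note finite_V = finite_vert[OF poly] and hull_V = convex_hull_vert[OF poly]
  have V_nonempty: "vert (X i) \<noteq> {}" for i
    using hull_V[of i] nonempty[of i] by (metis convex_hull_eq_empty)
  have lam_nonneg: "0 \<le> lam k" for k
    by (cases k) (auto simp: lam_0 lam_Suc orthant_proj_eq less_eq_vec_def)
  have x_vert: "x (Suc k) i \<in> vert (X i)" for k i
    using rule lam_nonneg[of k] by (auto simp: x_Suc minimizer_rule_def is_arg_min_linorder)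

  \<comment> \<open>The limit of the tightening \<open>\<rho>\<close>\<close>
  define f where "f i j k = (A i *v x (Suc k) i) $ j" for i j k
  define R where "R i j = range (f i j)" for i j
  have finite_R: "finite (R i j)" for i j
    unfolding R_def f_def
    by (rule finite_subset[OF _ finite_imageI[OF finite_V[of i], of "\<lambda>v. (A i *v v) $ j"]]) (use x_vert in auto)
  define M where "M j = (MAX i. Max (R i j) - Min (R i j))" for j
  define \<rho>lim :: "real^'p" where "\<rho>lim = (\<chi> j. real CARD('p) * M j)"
  have \<rho>i_eq: "\<rho>i (Suc k) i $ j = Max (f i j ` {..k}) - Min (f i j ` {..k})" for k i j
    using running_max_eq[of "\<lambda>k. smax k i j" "f i j" k] running_min_eq[of "\<lambda>k. smin k i j" "f i j" k]
    by (simp add: \<rho>i_Suc smax_0 smax_Suc smin_0 smin_Suc f_def)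
  have "\<forall>\<^sub>F k in sequentially. \<forall>i j. f i j ` {..k} = R i j"
    unfolding R_def
    by (intro eventually_all_finite eventually_image_atMost_eq_range) (simp add: finite_R flip: R_def)
  then have ev_\<rho>: "\<forall>\<^sub>F k in sequentially. \<rho> (Suc k) = \<rho>lim"
    by eventually_elim (simp add: \<rho>_Suc \<rho>i_eq \<rho>lim_def M_def)
  then have "(\<lambda>k. \<rho> (Suc k)) \<longlonglongrightarrow> \<rho>lim" by (rule tendsto_eventually)
  then have lim_\<rho>: "lim \<rho> = \<rho>lim" by (intro limI) (simp add: filterlim_sequentially_Suc)

  \<comment> \<open>Reduction to the linear program over the vertices\<close>
  interpret lp: decoupled_lp c A "b - \<rho>lim" "\<lambda>i. vert (X i)"
    by unfold_locales (fact finite_V V_nonempty)+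
  have dual_eq: "dual_objective c A b X \<rho>lim l = lp.dual_value l" for l
  proof -
    \<comment> \<open>A linear function on the hull of \<open>X i\<close> is minimized at a vertex,
      and vertices lie in \<open>X i\<close>.\<close>
    have "(INF v\<in>X i. (c i + l v* A i) \<bullet> v) = Min (lp.price i l ` vert (X i))" for i
    proof (rule cInf_eq_minimum)
      have "Min (lp.price i l ` vert (X i)) \<in> lp.price i l ` vert (X i)"
        using finite_V V_nonempty by (intro Min_in) auto
      then show "Min (lp.price i l ` vert (X i)) \<in> (\<lambda>v. (c i + l v* A i) \<bullet> v) ` X i"
        using vert_subset[of "X i"] by (auto simp: lp.price_def)
      fix t assume "t \<in> (\<lambda>v. (c i + l v* A i) \<bullet> v) ` X i"
      then obtain v where "v \<in> X i" "t = lp.price i l v" by (auto simp: lp.price_def)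
      then show "Min (lp.price i l ` vert (X i)) \<le> t"
        using lp.Min_price_le_hull[of v i l] by (simp add: hull_V hull_inc)
    qed
    then show ?thesis by (simp add: dual_objective_def lp.dual_value_def)
  qed
  obtain l0 where l0: "0 \<le> l0" "\<And>l. 0 \<le> l \<Longrightarrow> lp.dual_value l \<le> lp.dual_value l0"
    and l0_unique: "\<And>l. 0 \<le> l \<Longrightarrow> (\<And>l'. 0 \<le> l' \<Longrightarrow> lp.dual_value l' \<le> lp.dual_value l) \<Longrightarrow> l = l0"
    using unique_dual unfolding lim_\<rho> dual_solution_def is_arg_max_linorder dual_eq by metis
  interpret lp: unique_decoupled_lp c A "b - \<rho>lim" "\<lambda>i. vert (X i)" l0
  proof
    show "0 \<le> l0" by fact
    show "lp.dual_value l < lp.dual_value l0" if "0 \<le> l" "l \<noteq> l0" for l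
      using l0(2) l0_unique[OF that(1)] that by (meson not_le order_trans)
    show "y = z" if "is_arg_min (total_cost c) (feasible A (b - \<rho>lim) (\<lambda>i. convex hull vert (X i))) y"
      "is_arg_min (total_cost c) (feasible A (b - \<rho>lim) (\<lambda>i. convex hull vert (X i))) z" for y z
      using unique_primal that unfolding lim_\<rho> lp_solution_def hull_V by blast
  qed

  \<comment> \<open>From \<open>N\<close> on the right-hand side is fixed, so the run shifted by
    \<open>N\<close> is an ascent with \<open>r = b - \<rho>lim\<close>.\<close>
  obtain N where N: "\<And>k. k \<ge> N \<Longrightarrow> \<rho> (Suc k) = \<rho>lim"
    using ev_\<rho> by (auto simp: eventually_sequentially)
  obtain z where z: "is_arg_min (total_cost c) (feasible A (b - \<rho>lim) (\<lambda>i. convex hull vert (X i))) z"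
    "\<And>i. z i \<in> convex hull range (\<lambda>k. x (Suc (k + N)) i)"
    "\<forall>\<^sub>F k in sequentially. card {i. x (Suc (k + N)) i \<noteq> z i} \<le> CARD('p)"
  proof (rule lp.ascent_primal[of "\<lambda>k. \<alpha> (k + N)" "\<lambda>k. lam (k + N)" "\<lambda>k. x (Suc (k + N))"])
    show "x (Suc (k + N)) i \<in> lp.minimizers i (lam (k + N))" for k i
      using rule lam_nonneg[of "k + N"]
      by (auto simp: x_Suc minimizer_rule_def is_arg_min_linorder lp.minimizers_def lp.price_def)
    show "lam (Suc k + N) = orthant_proj (lam (k + N) +
        \<alpha> (k + N) *\<^sub>R (lp.load (x (Suc (k + N))) - (b - \<rho>lim)))" for k
      using lam_Suc[of "k + N"] N[of "k + N"] by (simp add: lp.load_def algebra_simps)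
  qed (use steps lam_nonneg in \<open>auto intro: step_sizes_shift\<close>)
  obtain K where K: "\<And>k. k \<ge> K \<Longrightarrow> card {i. x (Suc (k + N)) i \<noteq> z i} \<le> CARD('p)"
    using z(3) by (auto simp: eventually_sequentially)

  \<comment> \<open>Feasibility of the late iterates\<close>
  have Min_le_z: "Min (R i j) \<le> (A i *v z i) $ j" for i j
  proof -
    have "convex hull range (\<lambda>k. x (Suc (k + N)) i) \<subseteq> {v. row j (A i) \<bullet> v \<ge> Min (R i j)}"
    proof (intro hull_minimal convex_halfspace_ge subsetI)
      fix v assume "v \<in> range (\<lambda>k. x (Suc (k + N)) i)"
      then have "row j (A i) \<bullet> v \<in> R i j"
        by (auto simp: R_def f_def matrix_vector_mul_component row_def vec_lambda_eta)
      then show "v \<in> {v. row j (A i) \<bullet> v \<ge> Min (R i j)}" using finite_R by simp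
    qed
    then show ?thesis
      using z(2)[of i] by (auto simp: matrix_vector_mul_component row_def vec_lambda_eta)
  qed
  have z_load: "(\<Sum>i\<in>UNIV. A i *v z i) \<le> b - \<rho>lim"
    using z(1) by (simp add: is_arg_min_def feasible_def)
  have late: "feasible A b X (x (Suc (k + N)))" if "k \<ge> K" for k
  proof -
    define I where "I = {i. x (Suc (k + N)) i \<noteq> z i}"
    have "(\<Sum>i\<in>UNIV. A i *v x (Suc (k + N)) i) $ j \<le> b $ j" for j
    proof -
      have gap: "Max (R i j) - Min (R i j) \<le> M j" for i
        unfolding M_def by (intro Max_ge) auto
      \<comment> \<open>Needed to pass from \<open>card I\<close> to its upper bound
        \<open>CARD('p)\<close> as the factor of \<open>M j\<close>.\<close>
      have "0 \<le> M j"
      proof -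
        have "Min (R i j) \<le> Max (R i j)" for i
          using finite_R by (intro Min.coboundedI[THEN order_trans, OF _ _ Max_ge]) (auto simp: R_def)
        then show ?thesis using gap[of undefined] by (meson diff_ge_0_iff_ge order_trans)
      qed
      have "(\<Sum>i\<in>UNIV. A i *v x (Suc (k + N)) i) $ j - (\<Sum>i\<in>UNIV. A i *v z i) $ j
          = (\<Sum>i\<in>UNIV. f i j (k + N) - (A i *v z i) $ j)"
        by (simp add: f_def sum_subtractf)
      \<comment> \<open>Only agents deviating from \<open>z\<close> contribute; each adds at most
        its observed range, because \<open>z i\<close> loads no less than the observed
        minimum.\<close>
      also have "\<dots> = (\<Sum>i\<in>I. f i j (k + N) - (A i *v z i) $ j)"
        by (intro sum.mono_neutral_right) (auto simp: I_def f_def)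
      also have "\<dots> \<le> (\<Sum>i\<in>I. M j)"
      proof (rule sum_mono)
        fix i
        have "f i j (k + N) \<le> Max (R i j)"
          using finite_R by (intro Max_ge) (auto simp: R_def)
        then show "f i j (k + N) - (A i *v z i) $ j \<le> M j"
          using Min_le_z[of i j] gap[of i] by linarith
      qed
      also have "\<dots> \<le> real CARD('p) * M j"
        using K[OF that] \<open>0 \<le> M j\<close> by (simp add: I_def mult_right_mono)
      also have "\<dots> = \<rho>lim $ j" by (simp add: \<rho>lim_def)
      finally show ?thesis
        using z_load unfolding less_eq_vec_def by (smt (verit) vector_minus_component)
    qed
    moreover have "x (Suc (k + N)) i \<in> X i" for i
      using x_vert vert_subset by blast
    ultimately show ?thesis by (simp add: feasible_def less_eq_vec_def)
  qed
  have "feasible A b X (x k)" if "k \<ge> Suc (K + N)" for k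
  proof -
    define e where "e = k - Suc (K + N)"
    have "k = Suc ((K + e) + N)" using that by (simp add: e_def)
    then show ?thesis using late[of "K + e"] by simp
  qed
  then show ?thesis by blast
qed

end
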